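(* Let $X$ and $Y$ be nonempty metric spaces and let $f:X\to X$ and $g:Y\to Y$ be maps. If $f$ is coarsely embedded in $g$ and $g$ is coarsely embedded in $f$, then $h_\infty(f)=h_\infty(g)$. Therefore coarse entropy is an invariant of coarse conjugacy: if $f$ and $g$ are coarsely conjugate, then $h_\infty(f)=h_\infty(g)$. In particular, if the metric $d$ on $X$ is replaced by a metric $d'$ on $X$ that is bi-Lipschitz equivalent, or quasi-isometric, to $d$ (i.e. the identity map $(X,d)\to(X,d')$ is bi-Lipschitz, respectively a quasi-isometry), then the coarse entropy of $f$ does not change.
   Context: All metrics are denoted $d$. Maps are arbitrary (no continuity is assumed). Functions $L$ below are increasing functions $[0,\infty)\to[0,\infty)$. Controlled map: a map $\phi:X\to Y$ between metric spaces is controlled if there is an increasing function $L:[0,\infty)\to[0,\infty)$ with $d(\phi(x),\phi(x'))\le L(d(x,x'))$ for all $x,x'\in X$. If additionally $d(x,x')\le L(d(\phi(x),\phi(x')))$ for all $x,x'\in X$, then $\phi$ is a coarse embedding. If in addition to both there is a constant $M>0$ such that for every $y\in Y$ there is $x\in X$ with $d(y,\phi(x))\le M$, then $\phi$ is a coarse equivalence. Two maps $\phi,\phi':X\to Y$ are close if there is a constant $K>0$ with $d(\phi(x),\phi'(x))\le K$ for all $x\in X$. A map $\psi:Y\to X$ is a coarse inverse of $\phi:X\to Y$ if $\psi\circ\phi$ is close to the identity on $X$ and $\phi\circ\psi$ is close to the identity on $Y$. Maps $f:X\to X$ and $g:Y\to Y$ are coarsely conjugate if there exists a coarse equivalence $\phi:X\to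 Y$ with a coarse inverse $\psi:Y\to X$ such that $\phi\circ f$ is close to $g\circ\phi$ and $\psi\circ g$ is close to $f\circ\psi$. The map $f$ is coarsely embedded in $g$ if there exists a coarse embedding $\phi:X\to Y$ such that $\phi\circ f$ is close to $g\circ\phi$. Coarse entropy: a $\delta$-pseudoorbit of $f:X\to X$ of length $n$ starting at $x_0$ is a sequence $(x_0,x_1,\dots,x_n)$ in $X$ with $d(f(x_i),x_{i+1})\le\delta$ for $i=0,\dots,n-1$. The distance between $(x_0,\dots,x_n)$ and $(y_0,\dots,y_n)$ is $\max_{0\le i\le n}d(x_i,y_i)$. A set is $R$-separated if any two distinct elements are at distance at least $R$. Let $s(f,n,R,\delta,x_0)\in[1,\infty]$ be the supremum of cardinalities of $R$-separated sets of $\delta$-pseudoorbits of $f$ of length $n$ starting at $x_0$. The coarse entropy of $f$ is $$h_\infty(f)=\lim_{\delta\to\infty}\lim_{R\to\infty}\limsup_{n\to\infty}\frac1n\log s(f,n,R,\delta,x_0)\in[0,\infty];$$ it does not depend on the choice of $x_0\in X$ (and the limits in $R$ and $\delta$ exist by monotonicity). *)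

theory Defs
  imports "HOL-Analysis.Analysis"
begin

section \<open>Coarse maps\<close>

text \<open>
  Metric spaces are terms of the library type \<^typ>\<open>'a metric\<close>. Maps \<open>X \<rightarrow> Y\<close> are functions sending
  \<^term>\<open>mspace X\<close> into \<^term>\<open>mspace Y\<close>; their values outside \<^term>\<open>mspace X\<close> play no role.
  \<open>Increasing\<close> is read as non-decreasing.
\<close>

definition control_function :: "(real \<Rightarrow> real) \<Rightarrow> bool" where
  "control_function L \<longleftrightarrow> L \<in> {0..} \<rightarrow> {0..} \<and> mono_on {0..} L"

definition controlled_map :: "'a metric \<Rightarrow> 'b metric \<Rightarrow> ('a \<Rightarrow> 'b) \<Rightarrow> bool" where
  "controlled_map X Y \<phi> \<longleftrightarrow> \<phi> \<in> mspace X \<rightarrow> mspace Y \<and>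
     (\<exists>L. control_function L \<and>
          (\<forall>x\<in>mspace X. \<forall>x'\<in>mspace X. mdist Y (\<phi> x) (\<phi> x') \<le> L (mdist X x x')))"

definition coarse_embedding :: "'a metric \<Rightarrow> 'b metric \<Rightarrow> ('a \<Rightarrow> 'b) \<Rightarrow> bool" where
  "coarse_embedding X Y \<phi> \<longleftrightarrow> \<phi> \<in> mspace X \<rightarrow> mspace Y \<and>
     (\<exists>L. control_function L \<and>
          (\<forall>x\<in>mspace X. \<forall>x'\<in>mspace X. mdist Y (\<phi> x) (\<phi> x') \<le> L (mdist X x x') \<and>
                                      mdist X x x' \<le> L (mdist Y (\<phi> x) (\<phi> x'))))"

definition coarsely_surjective :: "'a metric \<Rightarrow> 'b metric \<Rightarrow> ('a \<Rightarrow> 'b) \<Rightarrow> bool" where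
  "coarsely_surjective X Y \<phi> \<longleftrightarrow>
     (\<exists>M>0. \<forall>y\<in>mspace Y. \<exists>x\<in>mspace X. mdist Y y (\<phi> x) \<le> M)"

definition coarse_equivalence :: "'a metric \<Rightarrow> 'b metric \<Rightarrow> ('a \<Rightarrow> 'b) \<Rightarrow> bool" where
  "coarse_equivalence X Y \<phi> \<longleftrightarrow> coarse_embedding X Y \<phi> \<and> coarsely_surjective X Y \<phi>"

definition close_maps :: "'a metric \<Rightarrow> 'b metric \<Rightarrow> ('a \<Rightarrow> 'b) \<Rightarrow> ('a \<Rightarrow> 'b) \<Rightarrow> bool" where
  "close_maps X Y \<phi> \<phi>' \<longleftrightarrow> (\<exists>K>0. \<forall>x\<in>mspace X. mdist Y (\<phi> x) (\<phi>' x) \<le> K)"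

definition coarse_inverse :: "'a metric \<Rightarrow> 'b metric \<Rightarrow> ('a \<Rightarrow> 'b) \<Rightarrow> ('b \<Rightarrow> 'a) \<Rightarrow> bool" where
  "coarse_inverse X Y \<phi> \<psi> \<longleftrightarrow> \<psi> \<in> mspace Y \<rightarrow> mspace X \<and>
     close_maps X X (\<psi> \<circ> \<phi>) id \<and> close_maps Y Y (\<phi> \<circ> \<psi>) id"

definition coarsely_conjugate ::
  "'a metric \<Rightarrow> ('a \<Rightarrow> 'a) \<Rightarrow> 'b metric \<Rightarrow> ('b \<Rightarrow> 'b) \<Rightarrow> bool" where
  "coarsely_conjugate X f Y g \<longleftrightarrow>
     (\<exists>\<phi> \<psi>. coarse_equivalence X Y \<phi> \<and> coarse_inverse X Y \<phi> \<psi> \<and>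
            close_maps X Y (\<phi> \<circ> f) (g \<circ> \<phi>) \<and> close_maps Y X (\<psi> \<circ> g) (f \<circ> \<psi>))"

definition coarsely_embedded ::
  "'a metric \<Rightarrow> ('a \<Rightarrow> 'a) \<Rightarrow> 'b metric \<Rightarrow> ('b \<Rightarrow> 'b) \<Rightarrow> bool" where
  "coarsely_embedded X f Y g \<longleftrightarrow>
     (\<exists>\<phi>. coarse_embedding X Y \<phi> \<and> close_maps X Y (\<phi> \<circ> f) (g \<circ> \<phi>))"

definition bi_lipschitz :: "'a metric \<Rightarrow> 'b metric \<Rightarrow> ('a \<Rightarrow> 'b) \<Rightarrow> bool" where
  "bi_lipschitz X Y \<phi> \<longleftrightarrow> \<phi> \<in> mspace X \<rightarrow> mspace Y \<and>
     (\<exists>C\<ge>1. \<forall>x\<in>mspace X. \<forall>x'\<in>mspace X.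
        mdist X x x' / C \<le> mdist Y (\<phi> x) (\<phi> x') \<and> mdist Y (\<phi> x) (\<phi> x') \<le> C * mdist X x x')"

definition quasi_isometry :: "'a metric \<Rightarrow> 'b metric \<Rightarrow> ('a \<Rightarrow> 'b) \<Rightarrow> bool" where
  "quasi_isometry X Y \<phi> \<longleftrightarrow> \<phi> \<in> mspace X \<rightarrow> mspace Y \<and>
     (\<exists>C\<ge>1. \<exists>B\<ge>0. \<forall>x\<in>mspace X. \<forall>x'\<in>mspace X.
        mdist X x x' / C - B \<le> mdist Y (\<phi> x) (\<phi> x') \<and>
        mdist Y (\<phi> x) (\<phi> x') \<le> C * mdist X x x' + B) \<and>
     coarsely_surjective X Y \<phi>"


section \<open>Coarse entropy\<close>

text \<open>A sequence \<open>(x\<^sub>0, \<dots>, x\<^sub>n)\<close> is a list of length \<open>n + 1\<close>.\<close>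

definition pseudoorbits ::
  "'a metric \<Rightarrow> ('a \<Rightarrow> 'a) \<Rightarrow> nat \<Rightarrow> real \<Rightarrow> 'a \<Rightarrow> 'a list set" where
  "pseudoorbits X f n \<delta> x0 =
     {xs. length xs = Suc n \<and> set xs \<subseteq> mspace X \<and> xs ! 0 = x0 \<and>
          (\<forall>i<n. mdist X (f (xs ! i)) (xs ! Suc i) \<le> \<delta>)}"

definition orbit_dist :: "'a metric \<Rightarrow> nat \<Rightarrow> 'a list \<Rightarrow> 'a list \<Rightarrow> real" where
  "orbit_dist X n xs ys = (MAX i\<in>{..n}. mdist X (xs ! i) (ys ! i))"

definition separated :: "'a metric \<Rightarrow> nat \<Rightarrow> real \<Rightarrow> 'a list set \<Rightarrow> bool" where
  "separated X n R A \<longleftrightarrow> (\<forall>xs\<in>A. \<forall>ys\<in>A. xs \<noteq> ys \<longrightarrow> R \<le> orbit_dist X n xs ys)"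

text \<open>Unlike \<^const>\<open>card\<close>, this assigns \<open>\<infinity>\<close> to infinite sets.\<close>

definition ecard :: "'a set \<Rightarrow> enat" where
  "ecard A = (if finite A then enat (card A) else \<infinity>)"

definition sep_number ::
  "'a metric \<Rightarrow> ('a \<Rightarrow> 'a) \<Rightarrow> nat \<Rightarrow> real \<Rightarrow> real \<Rightarrow> 'a \<Rightarrow> enat" where
  "sep_number X f n R \<delta> x0 =
     Sup {ecard A | A. A \<subseteq> pseudoorbits X f n \<delta> x0 \<and> separated X n R A}"

text \<open>The value at \<open>0\<close> is irrelevant, since \<^const>\<open>sep_number\<close> is at least \<open>1\<close>
  for a self-map of \<open>X\<close>, \<open>\<delta> \<ge> 0\<close> and a base point in \<open>X\<close>.\<close>

definition elog :: "enat \<Rightarrow> ereal" where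
  "elog s = (case s of enat k \<Rightarrow> ereal (ln (real k)) | \<infinity> \<Rightarrow> \<infinity>)"

definition sep_growth ::
  "'a metric \<Rightarrow> ('a \<Rightarrow> 'a) \<Rightarrow> real \<Rightarrow> real \<Rightarrow> 'a \<Rightarrow> ereal" where
  "sep_growth X f R \<delta> x0 =
     limsup (\<lambda>n. ereal (1 / real n) * elog (sep_number X f n R \<delta> x0))"

definition coarse_entropy_at :: "'a metric \<Rightarrow> ('a \<Rightarrow> 'a) \<Rightarrow> 'a \<Rightarrow> ereal" where
  "coarse_entropy_at X f x0 =
     Lim at_top (\<lambda>\<delta>. Lim at_top (\<lambda>R. sep_growth X f R \<delta> x0))"

text \<open>
  The choice of base point is immaterial, and the limits above exist: see \<open>coarse_entropy_eq\<close>,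
  \<open>tendsto_sep_growth\<close> and \<open>tendsto_coarse_entropy_at\<close> below.
\<close>

definition coarse_entropy :: "'a metric \<Rightarrow> ('a \<Rightarrow> 'a) \<Rightarrow> ereal" where
  "coarse_entropy X f = coarse_entropy_at X f (SOME x0. x0 \<in> mspace X)"


section \<open>Existence of the limits and independence of the base point\<close>

lemma tendsto_SUP_at_top_mono:
  fixes u :: "real \<Rightarrow> ereal"
  assumes "mono u"
  shows "(u \<longlongrightarrow> (SUP x. u x)) at_top"
proof (rule increasing_tendsto)
  show "\<forall>\<^sub>F x in at_top. u x \<le> (SUP x. u x)"
    by (simp add: SUP_upper)
  fix l assume "l < (SUP x. u x)"
  then obtain x where "l < u x" by (auto simp: less_SUP_iff)
  then show "\<forall>\<^sub>F y in at_top. l < u y"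
    unfolding eventually_at_top_linorder using monoD[OF assms] less_le_trans by blast
qed

lemma tendsto_INF_at_top_antimono:
  fixes u :: "real \<Rightarrow> ereal"
  assumes "antimono u"
  shows "(u \<longlongrightarrow> (INF x. u x)) at_top"
proof (rule decreasing_tendsto)
  show "\<forall>\<^sub>F x in at_top. (INF x. u x) \<le> u x"
    by (simp add: INF_lower)
  fix l assume "(INF x. u x) < l"
  then obtain x where "u x < l" by (auto simp: INF_less_iff)
  then show "\<forall>\<^sub>F y in at_top. u y < l"
    unfolding eventually_at_top_linorder using antimonoD[OF assms] le_less_trans by blast
qed

lemma elog_mono: "s \<le> t \<Longrightarrow> elog s \<le> elog t"
proof (cases s; cases t)
  fix j k assume "s \<le> t" "s = enat j" "t = enat k"
  then show ?thesis by (cases "j = 0"; cases "k = 0") (auto simp: elog_def)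
qed (auto simp: elog_def)

lemma sep_growth_mono:
  assumes "\<And>n. sep_number X f n R \<delta> x \<le> sep_number Y g n R' \<delta>' y"
  shows "sep_growth X f R \<delta> x \<le> sep_growth Y g R' \<delta>' y"
  unfolding sep_growth_def using assms
  by (intro Limsup_mono always_eventually allI ereal_mult_left_mono elog_mono) auto

lemma sep_number_antimono_R:
  "R \<le> R' \<Longrightarrow> sep_number X f n R' \<delta> x0 \<le> sep_number X f n R \<delta> x0"
  unfolding sep_number_def by (rule Sup_subset_mono) (force simp: separated_def)

lemma sep_number_mono_delta:
  "\<delta> \<le> \<delta>' \<Longrightarrow> sep_number X f n R \<delta> x0 \<le> sep_number X f n R \<delta>' x0"
  unfolding sep_number_def by (rule Sup_subset_mono) (force simp: pseudoorbits_def)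

lemma tendsto_sep_growth:
  "((\<lambda>R. sep_growth X f R \<delta> x0) \<longlongrightarrow> (INF R. sep_growth X f R \<delta> x0)) at_top"
  by (intro tendsto_INF_at_top_antimono antimonoI sep_growth_mono sep_number_antimono_R)

lemma Lim_sep_growth:
  "Lim at_top (\<lambda>R. sep_growth X f R \<delta> x0) = (INF R. sep_growth X f R \<delta> x0)"
  by (rule tendsto_Lim[OF _ tendsto_sep_growth]) simp

lemma
  shows tendsto_coarse_entropy_at:
    "((\<lambda>\<delta>. Lim at_top (\<lambda>R. sep_growth X f R \<delta> x0)) \<longlongrightarrow> coarse_entropy_at X f x0) at_top"
  and coarse_entropy_at_eq:
    "coarse_entropy_at X f x0 = (SUP \<delta>. INF R. sep_growth X f R \<delta> x0)"
proof -
  have *: "((\<lambda>\<delta>. Lim at_top (\<lambda>R. sep_growth X f R \<delta> x0))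
             \<longlongrightarrow> (SUP \<delta>. INF R. sep_growth X f R \<delta> x0)) at_top"
    unfolding Lim_sep_growth
    by (intro tendsto_SUP_at_top_mono monoI INF_mono' sep_growth_mono sep_number_mono_delta)
  then show "coarse_entropy_at X f x0 = (SUP \<delta>. INF R. sep_growth X f R \<delta> x0)"
    unfolding coarse_entropy_at_def by (intro tendsto_Lim) auto
  with * show "((\<lambda>\<delta>. Lim at_top (\<lambda>R. sep_growth X f R \<delta> x0))
                 \<longlongrightarrow> coarse_entropy_at X f x0) at_top"
    by simp
qed

lemma sep_number_base_point:
  assumes f: "f \<in> mspace X \<rightarrow> mspace X" and x: "x \<in> mspace X" and y: "y \<in> mspace X"
  shows "sep_number X f n R \<delta> y \<le> sep_number X f n R (\<delta> + mdist X (f x) (f y)) x"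
  unfolding sep_number_def
proof (rule Sup_subset_mono, clarify)
  fix A assume A: "A \<subseteq> pseudoorbits X f n \<delta> y" and sep: "separated X n R A"
  define T where "T = (\<lambda>xs. x # tl xs)"
  have form: "\<exists>zs. xs = y # zs \<and> length zs = n" if "xs \<in> A" for xs
    using that A by (cases xs) (auto simp: pseudoorbits_def)
  have nth_T: "T xs ! i = (if i = 0 then x else xs ! i)" if "xs \<in> A" for xs i
    using form[OF that] by (auto simp: T_def nth_Cons split: nat.splits)
  have inj: "inj_on T A"
    by (rule inj_onI) (metis T_def form list.inject list.sel(3))
  have "T xs \<in> pseudoorbits X f n (\<delta> + mdist X (f x) (f y)) x" if xs: "xs \<in> A" for xs
  proof -
    have P: "xs \<in> pseudoorbits X f n \<delta> y" using xs A by blast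
    have in_X: "xs ! i \<in> mspace X" if "i \<le> n" for i
      using P that nth_mem[of i xs] by (auto simp: pseudoorbits_def)
    have "mdist X (f (T xs ! i)) (T xs ! Suc i) \<le> \<delta> + mdist X (f x) (f y)" if i: "i < n" for i
    proof (cases "i = 0")
      case True
      have "mdist X (f x) (xs ! Suc 0) \<le> mdist X (f x) (f y) + mdist X (f y) (xs ! Suc 0)"
        using f x y in_X[of "Suc 0"] i True by (intro mdist_triangle) auto
      moreover have "mdist X (f y) (xs ! Suc 0) \<le> \<delta>"
        using P i True by (auto simp: pseudoorbits_def)
      ultimately show ?thesis using True by (simp add: nth_T[OF xs])
    next
      case False
      have "mdist X (f (xs ! i)) (xs ! Suc i) \<le> \<delta>"
        using P i by (auto simp: pseudoorbits_def)
      with False show ?thesis by (simp add: nth_T[OF xs] add_increasing2)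
    qed
    moreover have "length (T xs) = Suc n" "set (T xs) \<subseteq> mspace X" "T xs ! 0 = x"
      using form[OF xs] P x by (auto simp: T_def pseudoorbits_def)
    ultimately show ?thesis by (simp add: pseudoorbits_def)
  qed
  then have 1: "T ` A \<subseteq> pseudoorbits X f n (\<delta> + mdist X (f x) (f y)) x" by blast
  have "orbit_dist X n (T xs) (T ys) = orbit_dist X n xs ys" if "xs \<in> A" "ys \<in> A" for xs ys
  proof -
    have "mdist X (T xs ! i) (T ys ! i) = mdist X (xs ! i) (ys ! i)" for i
      using form[OF that(1)] form[OF that(2)] mdist_zero[THEN iffD2, OF x x refl]
        mdist_zero[THEN iffD2, OF y y refl]
      by (cases i) (auto simp: nth_T that)
    then show ?thesis by (simp add: orbit_dist_def)
  qed
  then have 2: "separated X n R (T ` A)"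
    using sep by (auto simp: separated_def)
  have "ecard A = ecard (T ` A)"
    using inj by (simp add: ecard_def card_image finite_image_iff)
  with 1 2 show "\<exists>B. ecard A = ecard B \<and>
      B \<subseteq> pseudoorbits X f n (\<delta> + mdist X (f x) (f y)) x \<and> separated X n R B"
    by blast
qed

lemma coarse_entropy_at_base_point:
  assumes "f \<in> mspace X \<rightarrow> mspace X" "x \<in> mspace X" "y \<in> mspace X"
  shows "coarse_entropy_at X f x = coarse_entropy_at X f y"
proof -
  have "coarse_entropy_at X f y \<le> coarse_entropy_at X f x"
    if "x \<in> mspace X" "y \<in> mspace X" for x y
    unfolding coarse_entropy_at_eq
  proof (rule SUP_least)
    fix \<delta>
    have "(INF R. sep_growth X f R \<delta> y) \<le> (INF R. sep_growth X f R (\<delta> + mdist X (f x) (f y)) x)"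
      by (intro INF_mono' sep_growth_mono sep_number_base_point assms(1) that)
    also have "\<dots> \<le> (SUP \<delta>. INF R. sep_growth X f R \<delta> x)"
      by (rule SUP_upper) simp
    finally show "(INF R. sep_growth X f R \<delta> y) \<le> (SUP \<delta>. INF R. sep_growth X f R \<delta> x)" .
  qed
  with assms show ?thesis by (intro antisym) auto
qed

lemma coarse_entropy_eq:
  assumes "f \<in> mspace X \<rightarrow> mspace X" "x0 \<in> mspace X"
  shows "coarse_entropy X f = coarse_entropy_at X f x0"
  unfolding coarse_entropy_def
  by (rule coarse_entropy_at_base_point[OF assms(1) someI[of _ x0] assms(2)]) (rule assms(2))

end

theory Submission
  imports Defs
begin

text \<open>
  If \<open>\<phi>\<close> embeds \<open>f\<close> coarsely in \<open>g\<close>, then applying \<open>\<phi>\<close> entrywise turns a \<open>\<delta>\<close>-pseudoorbit of \<open>f\<close>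
  into a \<open>\<delta>'\<close>-pseudoorbit of \<open>g\<close>, where \<open>\<delta>'\<close> does not depend on the length of the orbit, and keeps
  orbits \<open>R'\<close>-separated as soon as they were \<open>R\<close>-separated for a large \<open>R\<close> depending only on \<open>R'\<close>
  (lemma \<open>sep_number_coarse_embedding\<close>). Taking limits, coarse entropy is monotone under coarse
  embeddings (lemma \<open>coarse_entropy_mono\<close>), which gives equality for mutually embedded maps.

  The other two claims are instances of this: a coarse inverse of a coarse embedding is itself a
  coarse embedding, so coarsely conjugate maps are coarsely embedded in each other; and a change of
  metric for which the identity is bi-Lipschitz or a quasi-isometry makes the identity a coarse
  embedding in both directions, commuting with \<open>f\<close>.
\<close>

lemma control_functionD:
  assumes "control_function L"
  shows "0 \<le> t \<Longrightarrow> 0 \<le> L t" and "0 \<le> s \<Longrightarrow> s \<le> t \<Longrightarrow> L s \<le> L t"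
  using assms by (auto simp: control_function_def mono_on_def Pi_def)

lemma le_orbit_dist_iff:
  "R \<le> orbit_dist X n xs ys \<longleftrightarrow> (\<exists>i\<le>n. R \<le> mdist X (xs ! i) (ys ! i))"
  unfolding orbit_dist_def by (subst Max_ge_iff) auto

text \<open>
  The bounds on \<open>\<delta>'\<close> and \<open>R\<close> are uniform in \<open>n\<close>. Truncating \<open>\<delta>\<close> and \<open>R'\<close> at \<open>0\<close> keeps the arguments
  of \<open>L\<close> in its domain; strictness of \<open>L (max 0 R') < R\<close> makes the images of distinct separated
  orbits distinct, although \<open>\<phi>\<close> need not be injective.
\<close>
lemma sep_number_coarse_embedding:
  assumes f: "f \<in> mspace X \<rightarrow> mspace X" and g: "g \<in> mspace Y \<rightarrow> mspace Y"
    and \<phi>: "\<phi> \<in> mspace X \<rightarrow> mspace Y" and L: "control_function L"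
    and upper: "\<And>x x'. x \<in> mspace X \<Longrightarrow> x' \<in> mspace X \<Longrightarrow>
                  mdist Y (\<phi> x) (\<phi> x') \<le> L (mdist X x x')"
    and lower: "\<And>x x'. x \<in> mspace X \<Longrightarrow> x' \<in> mspace X \<Longrightarrow>
                  mdist X x x' \<le> L (mdist Y (\<phi> x) (\<phi> x'))"
    and K: "\<And>x. x \<in> mspace X \<Longrightarrow> mdist Y (\<phi> (f x)) (g (\<phi> x)) \<le> K"
    and \<delta>': "K + L (max 0 \<delta>) \<le> \<delta>'" and R: "L (max 0 R') < R"
  shows "sep_number X f n R \<delta> x0 \<le> sep_number Y g n R' \<delta>' (\<phi> x0)"
  unfolding sep_number_def
proof (rule Sup_subset_mono, clarify)
  fix A assume A: "A \<subseteq> pseudoorbits X f n \<delta> x0" and sep: "separated X n R A"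
  have len: "length xs = Suc n" and in_X: "i \<le> n \<Longrightarrow> xs ! i \<in> mspace X" if "xs \<in> A" for xs i
  proof -
    have P: "xs \<in> pseudoorbits X f n \<delta> x0" using that A by blast
    then show "length xs = Suc n" by (simp add: pseudoorbits_def)
    then show "xs ! i \<in> mspace X" if "i \<le> n"
      using P that nth_mem[of i xs] by (auto simp: pseudoorbits_def)
  qed
  have "map \<phi> xs \<in> pseudoorbits Y g n \<delta>' (\<phi> x0)" if xs: "xs \<in> A" for xs
  proof -
    have P: "xs \<in> pseudoorbits X f n \<delta> x0" using xs A by blast
    have "mdist Y (g (\<phi> (xs ! i))) (\<phi> (xs ! Suc i)) \<le> \<delta>'" if i: "i < n" for i
    proof -
      define x y where "x = xs ! i" and "y = xs ! Suc i"
      have x: "x \<in> mspace X" and y: "y \<in> mspace X"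
        using in_X[OF xs] i by (auto simp: x_def y_def)
      have "mdist X (f x) y \<le> max 0 \<delta>"
        using P i by (auto simp: x_def y_def pseudoorbits_def)
      then have "mdist Y (\<phi> (f x)) (\<phi> y) \<le> L (max 0 \<delta>)"
        using upper[of "f x" y] control_functionD(2)[OF L mdist_nonneg] f x y
        by (meson PiE order_trans)
      moreover have "mdist Y (g (\<phi> x)) (\<phi> y) \<le> mdist Y (g (\<phi> x)) (\<phi> (f x)) + mdist Y (\<phi> (f x)) (\<phi> y)"
        using f g \<phi> x y by (intro mdist_triangle) auto
      moreover have "mdist Y (g (\<phi> x)) (\<phi> (f x)) \<le> K"
        using K[OF x] by (simp add: mdist_commute)
      ultimately show ?thesis using \<delta>' by (simp add: x_def y_def)
    qed
    moreover have "length xs = Suc n" "set xs \<subseteq> mspace X" "xs ! 0 = x0"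
      using P by (auto simp: pseudoorbits_def)
    ultimately show ?thesis
      using \<phi> by (auto simp: pseudoorbits_def)
  qed
  then have 1: "map \<phi> ` A \<subseteq> pseudoorbits Y g n \<delta>' (\<phi> x0)" by blast
  have far: "\<exists>i\<le>n. max 0 R' < mdist Y (map \<phi> xs ! i) (map \<phi> ys ! i)"
    if "xs \<in> A" "ys \<in> A" "xs \<noteq> ys" for xs ys
  proof -
    obtain i where i: "i \<le> n" "R \<le> mdist X (xs ! i) (ys ! i)"
      using sep \<open>xs \<in> A\<close> \<open>ys \<in> A\<close> \<open>xs \<noteq> ys\<close> unfolding separated_def le_orbit_dist_iff by blast
    have "max 0 R' < mdist Y (\<phi> (xs ! i)) (\<phi> (ys ! i))"
    proof (rule ccontr)
      assume "\<not> ?thesis"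
      then have "L (mdist Y (\<phi> (xs ! i)) (\<phi> (ys ! i))) \<le> L (max 0 R')"
        by (intro control_functionD(2)[OF L]) auto
      with lower[of "xs ! i" "ys ! i"] in_X[of xs i] in_X[of ys i] that i R
      show False by linarith
    qed
    then show ?thesis using i(1) len that by auto
  qed
  have 2: "separated Y n R' (map \<phi> ` A)"
    unfolding separated_def le_orbit_dist_iff
  proof clarify
    fix xs ys assume "xs \<in> A" "ys \<in> A" "map \<phi> xs \<noteq> map \<phi> ys"
    with far[of xs ys] show "\<exists>i\<le>n. R' \<le> mdist Y (map \<phi> xs ! i) (map \<phi> ys ! i)"
      by (metis less_imp_le max.strict_boundedE)
  qed
  have "inj_on (map \<phi>) A"
  proof (rule inj_onI, rule ccontr)
    fix xs ys assume xs: "xs \<in> A" and ys: "ys \<in> A" and eq: "map \<phi> xs = map \<phi> ys" and "xs \<noteq> ys"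
    then obtain i where i: "i \<le> n" "0 < mdist Y (map \<phi> xs ! i) (map \<phi> xs ! i)"
      using far by fastforce
    have "map \<phi> xs ! i \<in> mspace Y"
      using in_X[OF xs i(1)] len[OF xs] i(1) \<phi> by auto
    then have "mdist Y (map \<phi> xs ! i) (map \<phi> xs ! i) = 0" by simp
    with i(2) show False by linarith
  qed
  then have "ecard A = ecard (map \<phi> ` A)"
    by (simp add: ecard_def card_image finite_image_iff)
  with 1 2 show "\<exists>B. ecard A = ecard B \<and>
      B \<subseteq> pseudoorbits Y g n \<delta>' (\<phi> x0) \<and> separated Y n R' B"
    by blast
qed

lemma coarse_entropy_mono:
  assumes X: "mspace X \<noteq> {}"
    and f: "f \<in> mspace X \<rightarrow> mspace X" and g: "g \<in> mspace Y \<rightarrow> mspace Y"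
    and emb: "coarsely_embedded X f Y g"
  shows "coarse_entropy X f \<le> coarse_entropy Y g"
proof -
  obtain x0 where x0: "x0 \<in> mspace X" using X by blast
  obtain \<phi> L K where \<phi>: "\<phi> \<in> mspace X \<rightarrow> mspace Y" and L: "control_function L"
    and bounds: "\<forall>x\<in>mspace X. \<forall>x'\<in>mspace X. mdist Y (\<phi> x) (\<phi> x') \<le> L (mdist X x x') \<and>
                                           mdist X x x' \<le> L (mdist Y (\<phi> x) (\<phi> x'))"
    and K: "\<forall>x\<in>mspace X. mdist Y (\<phi> (f x)) (g (\<phi> x)) \<le> K"
    using emb by (auto simp: coarsely_embedded_def coarse_embedding_def close_maps_def)
  have "coarse_entropy_at X f x0 \<le> coarse_entropy_at Y g (\<phi> x0)"
    unfolding coarse_entropy_at_eq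
  proof (rule SUP_mono)
    fix \<delta>
    have "(INF R. sep_growth X f R \<delta> x0) \<le> (INF R. sep_growth Y g R (K + L (max 0 \<delta>)) (\<phi> x0))"
    proof (rule INF_mono)
      fix R'
      have "sep_growth X f (L (max 0 R') + 1) \<delta> x0 \<le> sep_growth Y g R' (K + L (max 0 \<delta>)) (\<phi> x0)"
        using bounds K
        by (intro sep_growth_mono sep_number_coarse_embedding[OF f g \<phi> L, where K = K]) auto
      then show "\<exists>R\<in>UNIV. sep_growth X f R \<delta> x0 \<le> sep_growth Y g R' (K + L (max 0 \<delta>)) (\<phi> x0)"
        by blast
    qed
    then show "\<exists>\<delta>'\<in>UNIV. (INF R. sep_growth X f R \<delta> x0) \<le> (INF R. sep_growth Y g R \<delta>' (\<phi> x0))"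
      by blast
  qed
  moreover have "\<phi> x0 \<in> mspace Y" using \<phi> x0 by blast
  ultimately show ?thesis
    by (simp add: coarse_entropy_eq[OF f x0] coarse_entropy_eq[OF g])
qed

lemma coarse_embedding_coarse_inverse:
  assumes emb: "coarse_embedding X Y \<phi>" and inv: "coarse_inverse X Y \<phi> \<psi>"
  shows "coarse_embedding Y X \<psi>"
proof -
  obtain L where \<phi>: "\<phi> \<in> mspace X \<rightarrow> mspace Y" and L: "control_function L"
    and bounds: "\<forall>x\<in>mspace X. \<forall>x'\<in>mspace X. mdist Y (\<phi> x) (\<phi> x') \<le> L (mdist X x x') \<and>
                                           mdist X x x' \<le> L (mdist Y (\<phi> x) (\<phi> x'))"
    using emb by (auto simp: coarse_embedding_def)
  obtain K where \<psi>: "\<psi> \<in> mspace Y \<rightarrow> mspace X" and "K > 0"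
    and K: "\<forall>y\<in>mspace Y. mdist Y (\<phi> (\<psi> y)) y \<le> K"
    using inv by (auto simp: coarse_inverse_def close_maps_def)
  define L' where "L' t = L (t + 2 * K) + 2 * K" for t
  have L': "control_function L'"
    using \<open>K > 0\<close> unfolding control_function_def L'_def
    by (auto intro!: mono_onI control_functionD[OF L] add_nonneg_nonneg)
  have "mdist X (\<psi> y) (\<psi> y') \<le> L' (mdist Y y y') \<and> mdist Y y y' \<le> L' (mdist X (\<psi> y) (\<psi> y'))"
    if y: "y \<in> mspace Y" and y': "y' \<in> mspace Y" for y y'
  proof -
    define z z' where "z = \<phi> (\<psi> y)" and "z' = \<phi> (\<psi> y')"
    have \<psi>y: "\<psi> y \<in> mspace X" "\<psi> y' \<in> mspace X" using \<psi> y y' by auto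
    have z: "z \<in> mspace Y" "z' \<in> mspace Y" using \<phi> \<psi>y by (auto simp: z_def z'_def)
    have zK: "mdist Y z y \<le> K" "mdist Y z' y' \<le> K" using K y y' by (auto simp: z_def z'_def)
    have "mdist Y z z' \<le> mdist Y z y + mdist Y y y' + mdist Y z' y'"
      using mdist_triangle[of z Y y z'] mdist_triangle[of y Y y' z'] z y y'
      by (simp add: mdist_commute)
    then have "mdist Y z z' \<le> mdist Y y y' + 2 * K" using zK by linarith
    then have "L (mdist Y z z') \<le> L (mdist Y y y' + 2 * K)"
      by (intro control_functionD(2)[OF L]) auto
    then have "mdist X (\<psi> y) (\<psi> y') \<le> L' (mdist Y y y')"
      using bounds \<psi>y \<open>K > 0\<close> unfolding L'_def z_def z'_def by (smt (verit))
    moreover have "mdist Y y y' \<le> mdist Y z y + mdist Y z z' + mdist Y z' y'"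
      using mdist_triangle[of y Y z y'] mdist_triangle[of z Y z' y'] z y y'
      by (simp add: mdist_commute)
    moreover have "mdist Y z z' \<le> L (mdist X (\<psi> y) (\<psi> y'))"
      using bounds \<psi>y by (simp add: z_def z'_def)
    moreover have "L (mdist X (\<psi> y) (\<psi> y')) \<le> L (mdist X (\<psi> y) (\<psi> y') + 2 * K)"
      using \<open>K > 0\<close> by (intro control_functionD(2)[OF L]) auto
    ultimately show ?thesis using zK unfolding L'_def by linarith
  qed
  with \<psi> L' show ?thesis unfolding coarse_embedding_def by blast
qed

lemma coarsely_embedded_if_conjugate:
  assumes "coarsely_conjugate X f Y g"
  shows "coarsely_embedded X f Y g" and "coarsely_embedded Y g X f"
  using assms coarse_embedding_coarse_inverse
  unfolding coarsely_conjugate_def coarse_equivalence_def coarsely_embedded_def by blast+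

text \<open>A change of metric distorting distances at most affinely leaves the identity a coarse
  embedding; the bi-Lipschitz case is \<open>B = 0\<close>.\<close>
lemma coarse_embedding_id_if_affine_distortion:
  assumes sp: "mspace X \<subseteq> mspace Y" and C: "C \<ge> 1" and B: "B \<ge> 0"
    and bounds: "\<And>x x'. x \<in> mspace X \<Longrightarrow> x' \<in> mspace X \<Longrightarrow>
        mdist X x x' / C - B \<le> mdist Y x x' \<and> mdist Y x x' \<le> C * mdist X x x' + B"
  shows "coarse_embedding X Y id"
proof -
  define L where "L t = C * (t + B)" for t
  have "control_function L"
    using C B by (auto simp: control_function_def L_def intro!: mono_onI)
  moreover have "mdist Y x x' \<le> L (mdist X x x') \<and> mdist X x x' \<le> L (mdist Y x x')"
    if "x \<in> mspace X" "x' \<in> mspace X" for x x'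
  proof
    have "B \<le> C * B" using C B by (simp add: mult_le_cancel_right1)
    then show "mdist Y x x' \<le> L (mdist X x x')"
      using bounds[OF that] by (simp add: L_def distrib_left)
    have "mdist X x x' / C \<le> mdist Y x x' + B" using bounds[OF that] by simp
    then show "mdist X x x' \<le> L (mdist Y x x')"
      using C by (simp add: L_def pos_divide_le_eq mult.commute)
  qed
  ultimately show ?thesis using sp by (auto simp: coarse_embedding_def)
qed

lemma coarse_embedding_id_sym:
  assumes "mspace X = mspace Y" and "coarse_embedding X Y id"
  shows "coarse_embedding Y X id"
  using assms unfolding coarse_embedding_def by auto

lemma coarsely_embedded_id:
  assumes "coarse_embedding X Y id" and "f \<in> mspace X \<rightarrow> mspace X"
  shows "coarsely_embedded X f Y f"
proof -
  have "mdist Y (f x) (f x) = 0" if "x \<in> mspace X" for x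
  proof -
    have "f x \<in> mspace Y" using assms that by (auto simp: coarse_embedding_def)
    then show ?thesis by simp
  qed
  then have "close_maps X Y (id \<circ> f) (f \<circ> id)"
    unfolding close_maps_def by (intro exI[of _ 1]) simp
  with assms(1) show ?thesis unfolding coarsely_embedded_def by blast
qed

theorem corollary3p2:
  fixes X :: "'a metric" and Y :: "'b metric"
    and f :: "'a \<Rightarrow> 'a" and g :: "'b \<Rightarrow> 'b"
  assumes "mspace X \<noteq> {}" and "mspace Y \<noteq> {}"
    and "f \<in> mspace X \<rightarrow> mspace X" and "g \<in> mspace Y \<rightarrow> mspace Y"
  shows "(coarsely_embedded X f Y g \<and> coarsely_embedded Y g X f
            \<longrightarrow> coarse_entropy X f = coarse_entropy Y g) \<and>
         (coarsely_conjugate X f Y g \<longrightarrow> coarse_entropy X f = coarse_entropy Y g) \<and>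
         (\<forall>X' :: 'a metric. mspace X' = mspace X \<and> (bi_lipschitz X X' id \<or> quasi_isometry X X' id)
            \<longrightarrow> coarse_entropy X' f = coarse_entropy X f)"
proof -
  have mutual: "coarse_entropy X f = coarse_entropy Y g"
    if "coarsely_embedded X f Y g" "coarsely_embedded Y g X f"
    by (rule antisym[OF coarse_entropy_mono coarse_entropy_mono]) (fact assms that)+
  have "coarse_entropy X' f = coarse_entropy X f"
    if sp: "mspace X' = mspace X" and qi: "bi_lipschitz X X' id \<or> quasi_isometry X X' id"
    for X' :: "'a metric"
  proof -
    obtain C B where "C \<ge> 1" "B \<ge> 0" and "\<forall>x\<in>mspace X. \<forall>x'\<in>mspace X.
        mdist X x x' / C - B \<le> mdist X' x x' \<and> mdist X' x x' \<le> C * mdist X x x' + B"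
      using qi
    proof
      assume "bi_lipschitz X X' id"
      then show ?thesis
        using that[of _ 0] by (auto simp: bi_lipschitz_def)
    next
      assume "quasi_isometry X X' id"
      then show ?thesis
        using that unfolding quasi_isometry_def id_apply by blast
    qed
    then have emb: "coarse_embedding X X' id"
      using sp by (intro coarse_embedding_id_if_affine_distortion[of _ _ C B]) auto
    have "coarse_embedding X' X id"
      using coarse_embedding_id_sym[OF sp[symmetric] emb] .
    with emb sp assms(1,3) show ?thesis
      by (intro antisym coarse_entropy_mono coarsely_embedded_id) auto
  qed
  with mutual coarsely_embedded_if_conjugate show ?thesis by blast
qed

end
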